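(* Let $\alpha$ be a composition of $n$ and let $m_i$ be the number of parts of $\alpha$ equal to $i$. Then $$\Phi_\alpha=\binom{m_1+\cdots+m_n}{m_1,\dots,m_n}^{-1}\sum_{\gamma\vDash n}\Bigl(\sum_{\beta\succcurlyeq(\gamma\wedge\alpha)}(-1)^{\ell(\gamma)-\ell(\beta)}|\mathrm{OSP}(\alpha,\beta)|\Bigr)F_\gamma,$$ where $\gamma\vDash n$ ranges over compositions of $n$.
   Context: A composition of $n$ is a sequence of positive integers summing to $n$; $\ell(\cdot)$ is the number of parts. $\mathrm{set}(\alpha)=\{\alpha_1,\alpha_1+\alpha_2,\dots\}\subseteq[n-1]$. $\alpha\preccurlyeq\beta$ ($\beta\succcurlyeq\alpha$) iff $\mathrm{set}(\beta)\subseteq\mathrm{set}(\alpha)$, i.e.\ $\beta$ is obtained from $\alpha$ by summing consecutive blocks; $\alpha^{(i)}$ is the block of parts of $\alpha$ summing to $\beta_i$. $\gamma\wedge\alpha$ is the composition with set $\mathrm{set}(\gamma)\cap\mathrm{set}(\alpha)$ (finest common coarsening). $M_\beta=\sum_{i_1<\cdots<i_r}x_{i_1}^{\beta_1}\cdots x_{i_r}^{\beta_r}$, $F_\alpha=\sum_{\beta\preccurlyeq\alpha}M_\beta$. $z_\alpha=\prod_i i^{m_i}m_i!$. $\mathrm{sp}(\gamma)=\ell(\gamma)!\prod_j\gamma_j$, $\mathrm{sp}(\alpha,\beta)=\prod_i\mathrm{sp}(\alpha^{(i)})$, and $\Phi_\alpha=z_\alpha\sum_{\beta\succcurlyeq\alpha}\frac{1}{\mathrm{sp}(\alpha,\beta)}M_\beta$.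 For $\alpha\preccurlyeq\beta$, $\mathrm{OSP}(\alpha,\beta)$ is the set of ordered set partitions $(B_1,\dots,B_{\ell(\beta)})$ of $\{1,\dots,\ell(\alpha)\}$ with $|B_i|=\ell(\alpha^{(i)})$; $\mathrm{OSP}(\alpha,\beta)=\emptyset$ otherwise. *)

theory Defs
  imports Complex_Main "HOL-Library.Poly_Mapping" "HOL-Library.Disjoint_Sets"
begin

definition compositions :: "nat \<Rightarrow> nat list set" where
  "compositions n = {\<alpha>. (\<forall>a\<in>set \<alpha>. 0 < a) \<and> sum_list \<alpha> = n}"

text \<open>The set of proper partial sums of a composition; the total is excluded,
  so that it is a subset of \<open>{1..n - 1}\<close>.\<close>

definition comp_set :: "nat list \<Rightarrow> nat set" where
  "comp_set \<alpha> = {sum_list (take k \<alpha>) | k. 1 \<le> k \<and> k < length \<alpha>}"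

text \<open>\<open>\<alpha> \<preceq> \<beta>\<close> says that the two are compositions of the same number and
  that \<open>\<beta>\<close> is the coarser one.\<close>

definition refines :: "nat list \<Rightarrow> nat list \<Rightarrow> bool"  (infix \<open>\<preceq>\<close> 50) where
  "\<alpha> \<preceq> \<beta> \<longleftrightarrow>
     (\<exists>n. \<alpha> \<in> compositions n \<and> \<beta> \<in> compositions n) \<and> comp_set \<beta> \<subseteq> comp_set \<alpha>"

text \<open>For \<open>\<alpha> \<preceq> \<beta>\<close>, the list of the blocks \<open>\<alpha>\<^sup>(\<^sup>1\<^sup>), \<alpha>\<^sup>(\<^sup>2\<^sup>), \<dots>\<close>: consecutive pieces
  of \<open>\<alpha>\<close>, the \<open>i\<close>-th of which sums to \<open>\<beta>\<^sub>i\<close>. They exist uniquely in this case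
  because all parts are positive; otherwise the value is unspecified.
  Lists are indexed from 0.\<close>

definition blocks :: "nat list \<Rightarrow> nat list \<Rightarrow> nat list list" where
  "blocks \<alpha> \<beta> = (THE bs. concat bs = \<alpha> \<and> map sum_list bs = \<beta>)"

text \<open>The finest common coarsening, for compositions of the same number.\<close>

definition coarsening :: "nat list \<Rightarrow> nat list \<Rightarrow> nat list" where
  "coarsening \<gamma> \<alpha> =
     (THE \<delta>. \<delta> \<in> compositions (sum_list \<alpha>) \<and> comp_set \<delta> = comp_set \<gamma> \<inter> comp_set \<alpha>)"

text \<open>Formal power series in variables \<open>x\<^sub>0, x\<^sub>1, \<dots>\<close>, given by their coefficients;
  a monomial is its finitely supported exponent vector, so that the product of
  monomials is the sum of exponent vectors.\<close>

type_synonym 'a power_series = "(nat \<Rightarrow>\<^sub>0 nat) \<Rightarrow> 'a"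

definition monomial_at :: "nat list \<Rightarrow> nat list \<Rightarrow> (nat \<Rightarrow>\<^sub>0 nat)" where
  "monomial_at is \<beta> = (\<Sum>j<length \<beta>. Poly_Mapping.single (is ! j) (\<beta> ! j))"

text \<open>The coefficient of \<open>x\<^sup>m\<close> in \<open>M\<^sub>\<beta>\<close> is the number of summands
  \<open>x\<^sub>i\<^sub>1\<^sup>\<beta>\<^sup>1 \<cdots> x\<^sub>i\<^sub>r\<^sup>\<beta>\<^sup>r\<close> (with \<open>i\<^sub>1 < \<cdots> < i\<^sub>r\<close>) equal to it; there is at most one.\<close>

definition Mqsym :: "nat list \<Rightarrow> 'a::field_char_0 power_series" where
  "Mqsym \<beta> = (\<lambda>m. of_nat (card {is. length is = length \<beta> \<and> sorted_wrt (<) is \<and> monomial_at is \<beta> = m}))"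

definition Fqsym :: "nat list \<Rightarrow> 'a::field_char_0 power_series" where
  "Fqsym \<alpha> = (\<lambda>m. \<Sum>\<beta> | \<beta> \<preceq> \<alpha>. Mqsym \<beta> m)"

definition z_comp :: "nat list \<Rightarrow> nat" where
  "z_comp \<alpha> = (\<Prod>i=1..sum_list \<alpha>. i ^ count_list \<alpha> i * fact (count_list \<alpha> i))"

definition sp :: "nat list \<Rightarrow> nat" where
  "sp \<gamma> = fact (length \<gamma>) * prod_list \<gamma>"

definition sp_rel :: "nat list \<Rightarrow> nat list \<Rightarrow> nat" where
  "sp_rel \<alpha> \<beta> = prod_list (map sp (blocks \<alpha> \<beta>))"

definition Phi :: "nat list \<Rightarrow> 'a::field_char_0 power_series" where
  "Phi \<alpha> = (\<lambda>m. of_nat (z_comp \<alpha>) * (\<Sum>\<beta> | \<alpha> \<preceq> \<beta>. (1 / of_nat (sp_rel \<alpha> \<beta>)) * Mqsym \<beta> m))"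

definition OSP :: "nat list \<Rightarrow> nat list \<Rightarrow> nat set list set" where
  "OSP \<alpha> \<beta> =
     (if \<alpha> \<preceq> \<beta> then
        {Bs. distinct Bs \<and> partition_on {1..length \<alpha>} (set Bs) \<and> length Bs = length \<beta> \<and>
             (\<forall>i<length \<beta>. card (Bs ! i) = length (blocks \<alpha> \<beta> ! i))}
      else {})"

definition multinomial :: "nat list \<Rightarrow> 'a::field_char_0" where
  "multinomial ks = fact (sum_list ks) / prod_list (map fact ks)"

lemma finite_compositions: "finite (compositions n)"
proof -
  have len: "length xs \<le> sum_list xs" if "\<forall>a\<in>set xs. 0 < a" for xs :: "nat list"
    using that by (induction xs) auto
  have "compositions n \<subseteq> {xs. set xs \<subseteq> {..n} \<and> length xs \<le> n}"
    using len member_le_sum_list by (fastforce simp: compositions_def)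
  thus ?thesis
    by (rule finite_subset) (simp add: finite_lists_length_le)
qed

end

theory Submission
  imports Defs
begin

text \<open>Counting ordered set partitions by a multinomial coefficient identifies
  \<open>z\<^sub>\<alpha> / sp(\<alpha>, \<beta>)\<close> with \<open>|OSP(\<alpha>, \<beta>)|\<close> divided by the multinomial coefficient of the
  \<open>m\<^sub>i\<close>, so that \<open>\<Phi>\<^sub>\<alpha>\<close> is, up to this constant, the sum of \<open>|OSP(\<alpha>, \<beta>)| M\<^sub>\<beta>\<close> over
  \<open>\<beta> \<succeq> \<alpha>\<close>. Compositions of \<open>n\<close> correspond to subsets of \<open>{1..<n}\<close>, and Moebius
  inversion in the Boolean lattice gives \<open>M\<^sub>\<beta> = (\<Sum>\<gamma> \<preceq> \<beta>. (-1)^(\<ell>(\<gamma>) - \<ell>(\<beta>)) F\<^sub>\<gamma>)\<close>.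
  The two sums can then be exchanged, since \<open>\<beta>\<close> lies above both \<open>\<alpha>\<close> and \<open>\<gamma>\<close> if and only
  if it lies above \<open>\<gamma> \<and> \<alpha>\<close>.\<close>

section \<open>Compositions of \<open>n\<close> and subsets of \<open>{1..<n}\<close>\<close>

lemma compositions_Cons [simp]:
  "a # \<alpha> \<in> compositions n \<longleftrightarrow> 0 < a \<and> a \<le> n \<and> \<alpha> \<in> compositions (n - a)"
  by (auto simp: compositions_def)

lemma compositions_Nil [simp]: "[] \<in> compositions n \<longleftrightarrow> n = 0"
  by (auto simp: compositions_def)

lemma compositions_sum_list: "\<alpha> \<in> compositions n \<Longrightarrow> sum_list \<alpha> = n"
  by (auto simp: compositions_def)

lemma compositions_0 [simp]: "\<alpha> \<in> compositions 0 \<longleftrightarrow> \<alpha> = []"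
  by (cases \<alpha>) auto

lemma comp_set_Nil [simp]: "comp_set [] = {}"
  by (auto simp: comp_set_def)

text \<open>The head is the first proper partial sum, and every later one is \<open>a\<close> plus a
  partial sum of the tail. With an empty tail \<open>a\<close> is the total, which
  \<open>comp_set\<close> leaves out. The inductions below rest on this recursion.\<close>

lemma comp_set_Cons:
  "comp_set (a # \<alpha>) = (if \<alpha> = [] then {} else insert a ((+) a ` comp_set \<alpha>))"
proof (cases "\<alpha> = []")
  case False
  have "x \<in> comp_set (a # \<alpha>) \<longleftrightarrow> x \<in> insert a ((+) a ` comp_set \<alpha>)" for x
  proof
    assume "x \<in> comp_set (a # \<alpha>)"
    then obtain k where k: "1 \<le> k" "k < length (a # \<alpha>)" "x = sum_list (take k (a # \<alpha>))"
      by (auto simp: comp_set_def)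
    then obtain j where j: "k = Suc j" by (cases k) auto
    show "x \<in> insert a ((+) a ` comp_set \<alpha>)"
      using k j by (cases "j = 0") (force simp: comp_set_def)+
  next
    assume "x \<in> insert a ((+) a ` comp_set \<alpha>)"
    then consider "x = a" | k where "1 \<le> k" "k < length \<alpha>" "x = a + sum_list (take k \<alpha>)"
      by (auto simp: comp_set_def)
    then show "x \<in> comp_set (a # \<alpha>)"
    proof cases
      case 1
      then show ?thesis
        using False by (auto simp: comp_set_def intro!: exI[of _ 1])
    next
      case 2
      then show ?thesis
        by (auto simp: comp_set_def intro!: exI[of _ "Suc k"])
    qed
  qed
  then show ?thesis using False by auto
qed (auto simp: comp_set_def)

lemma comp_set_subset: "\<alpha> \<in> compositions n \<Longrightarrow> comp_set \<alpha> \<subseteq> {1..<n}"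
proof (induction \<alpha> arbitrary: n)
  case (Cons a \<alpha>)
  then have IH: "comp_set \<alpha> \<subseteq> {1..<n - a}" and a: "0 < a" "a \<le> n" by auto
  \<comment> \<open>A nonempty tail has a positive head, so \<open>a\<close> alone cannot exhaust
    \<open>n\<close>.\<close>
  have "a < n" if "\<alpha> \<noteq> []"
    using Cons.prems that by (cases \<alpha>) auto
  then show ?case
    using a by (auto simp: comp_set_Cons dest!: IH[THEN subsetD])
qed auto

lemma finite_comp_set: "finite (comp_set \<alpha>)"
  by (induction \<alpha>) (auto simp: comp_set_Cons)

text \<open>Positive parts make the partial sums distinct, and only the total is dropped. For
  \<open>[]\<close> truncated subtraction gives the right value.\<close>

lemma card_comp_set: "\<alpha> \<in> compositions n \<Longrightarrow> card (comp_set \<alpha>) = length \<alpha> - 1"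
proof (induction \<alpha> arbitrary: n)
  case (Cons a \<alpha>)
  then have IH: "card (comp_set \<alpha>) = length \<alpha> - 1"
    and "0 \<notin> comp_set \<alpha>"
    using comp_set_subset[of \<alpha> "n - a"] by auto
  then show ?case
    by (auto simp: comp_set_Cons card_insert_if finite_comp_set card_image)
qed auto

lemma comp_set_inj:
  "\<alpha> \<in> compositions n \<Longrightarrow> \<beta> \<in> compositions n \<Longrightarrow> comp_set \<alpha> = comp_set \<beta> \<Longrightarrow> \<alpha> = \<beta>"
proof (induction \<alpha> arbitrary: \<beta> n)
  case Nil
  then show ?case by simp
next
  case (Cons a \<alpha>)
  then obtain b \<beta>' where \<beta>: "\<beta> = b # \<beta>'" by (cases \<beta>) auto
  have *: "comp_set \<alpha> \<subseteq> {1..<n - a}" "comp_set \<beta>' \<subseteq> {1..<n - b}"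
    using Cons.prems(1,2) \<beta> by (simp_all only: compositions_Cons comp_set_subset)
  show ?case
  proof (cases "\<alpha> = []")
    case True
    with Cons.prems(3) \<beta> have "\<beta>' = []" by (auto simp: comp_set_Cons split: if_splits)
    then show ?thesis using True Cons.prems(1,2) \<beta> by simp
  next
    case False
    with Cons.prems(3) \<beta> have ne: "\<beta>' \<noteq> []" by (auto simp: comp_set_Cons split: if_splits)
    have eq: "insert a ((+) a ` comp_set \<alpha>) = insert b ((+) b ` comp_set \<beta>')"
      using Cons.prems(3) False ne \<beta> by (simp add: comp_set_Cons)
    \<comment> \<open>Elements of the left-hand set are at least \<open>a\<close>, those of the
      right-hand one at least \<open>b\<close>, so each head bounds the other.\<close>
    have "a \<in> insert b ((+) b ` comp_set \<beta>')" "b \<in> insert a ((+) a ` comp_set \<alpha>)"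
      using eq by blast+
    then have ab: "a = b" by auto
    \<comment> \<open>Partial sums of the tails are positive, so the shifted sets omit
      \<open>a\<close> and the inserted element can be removed from both sides.\<close>
    have "a \<notin> (+) a ` comp_set \<alpha>" "a \<notin> (+) a ` comp_set \<beta>'"
      using * by auto
    then have "(+) a ` comp_set \<alpha> = (+) a ` comp_set \<beta>'"
      using eq ab by (metis insert_ident)
    then have "comp_set \<alpha> = comp_set \<beta>'"
      by (simp add: inj_image_eq_iff)
    then show ?thesis using Cons.IH[of "n - a" \<beta>'] Cons.prems(1,2) \<beta> ab by simp
  qed
qed

text \<open>The least element of \<open>S\<close> becomes the first part; the other elements,
  shifted down by it, yield the tail by strong induction.\<close>

lemma comp_set_surj: "S \<subseteq> {1..<n} \<Longrightarrow> \<exists>\<alpha>\<in>compositions n. comp_set \<alpha> = S"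
proof (induction n arbitrary: S rule: less_induct)
  case (less n)
  show ?case
  proof (cases "S = {}")
    case True
    \<comment> \<open>A single part has no proper partial sum; for \<open>n = 0\<close> that part
      would not be positive, so \<open>[]\<close> is taken.\<close>
    then show ?thesis
      by (intro bexI[of _ "if n = 0 then [] else [n]"]) (simp_all add: comp_set_Cons)
  next
    case False
    have fin: "finite S" using less.prems finite_subset by blast
    define a where "a = Min S"
    have a: "a \<in> S" "\<And>x. x \<in> S \<Longrightarrow> a \<le> x"
      using fin False by (auto simp: a_def)
    then have an: "0 < a" "a < n" using less.prems by auto
    define S' where "S' = (\<lambda>x. x - a) ` (S - {a})"
    have "S' \<subseteq> {1..<n - a}"
      using a less.prems by (force simp: S'_def)
    then obtain \<alpha> where \<alpha>: "\<alpha> \<in> compositions (n - a)" "comp_set \<alpha> = S'"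
      using less.IH[of "n - a" S'] an by auto
    \<comment> \<open>Since \<open>n - a\<close> is positive the tail is nonempty, so
      \<open>a\<close> is a proper partial sum.\<close>
    have "\<alpha> \<noteq> []" using \<alpha> an by auto
    moreover have "(+) a ` S' = S - {a}"
      using a by (force simp: S'_def image_image)
    ultimately have "comp_set (a # \<alpha>) = S"
      using a \<alpha> by (auto simp: comp_set_Cons)
    then show ?thesis using \<alpha> an by (intro bexI[of _ "a # \<alpha>"]) auto
  qed
qed

section \<open>Refinement order and finest common coarsening\<close>

lemma coarsening_props:
  assumes "\<gamma> \<in> compositions n" "\<alpha> \<in> compositions n"
  shows "coarsening \<gamma> \<alpha> \<in> compositions n"
    and "comp_set (coarsening \<gamma> \<alpha>) = comp_set \<gamma> \<inter> comp_set \<alpha>"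
proof -
  have sum: "sum_list \<alpha> = n" using assms(2) by (rule compositions_sum_list)
  have "comp_set \<gamma> \<inter> comp_set \<alpha> \<subseteq> {1..<n}"
    using comp_set_subset[OF assms(1)] by blast
  then obtain \<delta> where "\<delta> \<in> compositions n" "comp_set \<delta> = comp_set \<gamma> \<inter> comp_set \<alpha>"
    using comp_set_surj by blast
  \<comment> \<open>Surjectivity and injectivity of \<open>comp_set\<close> give existence and
    uniqueness, which make the definite description in \<open>coarsening\<close> meaningful.\<close>
  then have "\<exists>!\<delta>. \<delta> \<in> compositions (sum_list \<alpha>) \<and> comp_set \<delta> = comp_set \<gamma> \<inter> comp_set \<alpha>"
    unfolding sum by (intro ex1I[of _ \<delta>]) (auto intro: comp_set_inj)
  from theI'[OF this, folded coarsening_def, unfolded sum]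
  show "coarsening \<gamma> \<alpha> \<in> compositions n"
    and "comp_set (coarsening \<gamma> \<alpha>) = comp_set \<gamma> \<inter> comp_set \<alpha>" by auto
qed

lemma refines_iff:
  assumes "\<alpha> \<in> compositions n"
  shows "\<alpha> \<preceq> \<beta> \<longleftrightarrow> \<beta> \<in> compositions n \<and> comp_set \<beta> \<subseteq> comp_set \<alpha>"
    and "\<beta> \<preceq> \<alpha> \<longleftrightarrow> \<beta> \<in> compositions n \<and> comp_set \<alpha> \<subseteq> comp_set \<beta>"
  using assms by (auto simp: refines_def compositions_def)

text \<open>Coarser means smaller set, and a set lies in an intersection iff it lies in both sets.
  Thus the coarsening is the least upper bound of \<gamma> and \<alpha>.\<close>

lemma coarsening_refines_iff:
  assumes "\<gamma> \<in> compositions n" "\<alpha> \<in> compositions n"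
  shows "coarsening \<gamma> \<alpha> \<preceq> \<beta> \<longleftrightarrow> \<gamma> \<preceq> \<beta> \<and> \<alpha> \<preceq> \<beta>"
  using coarsening_props[OF assms] assms by (auto simp: refines_iff)

section \<open>Existence and uniqueness of blocks\<close>

lemma append_eq_append_sum_list:
  fixes xs ys us vs :: "nat list"
  assumes "xs @ us = ys @ vs" "sum_list xs = sum_list ys" "\<forall>a\<in>set (xs @ us). 0 < a"
  shows "xs = ys"
proof -
  \<comment> \<open>One prefix extends the other by \<open>zs\<close>; equal sums and positive parts
    force \<open>zs\<close> to be empty.\<close>
  obtain zs where zs: "xs = ys @ zs \<or> ys = xs @ zs"
    using assms(1) by (auto simp: append_eq_append_conv2)
  then have "sum_list zs = 0" using assms(2) by auto
  then have "\<forall>a\<in>set zs. a = 0" by simp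
  moreover have "\<forall>a\<in>set zs. 0 < a"
    using zs assms(1,3) by (metis Un_iff set_append)
  ultimately have "zs = []" by (cases zs) auto
  with zs show ?thesis by auto
qed

lemma blocks_unique:
  fixes bs cs :: "nat list list"
  assumes "concat bs = concat cs" "map sum_list bs = map sum_list cs"
    "\<forall>a\<in>set (concat bs). 0 < a"
  shows "bs = cs"
  using assms
proof (induction bs arbitrary: cs)
  case (Cons b bs)
  then obtain c cs' where cs: "cs = c # cs'" by (cases cs) auto
  have "b = c"
    using Cons.prems cs by (intro append_eq_append_sum_list[of b "concat bs" c "concat cs'"]) auto
  then show ?case using Cons cs by auto
qed auto

text \<open>Unless it is the only part, the first part \<open>b\<close> of \<beta> is a proper
  partial sum of \<alpha>, hence the sum of a prefix \<open>take k \<alpha>\<close>. This prefix is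
  the first block, and induction cuts up the rest.\<close>

lemma blocks_exist:
  assumes "\<alpha> \<in> compositions n" "\<beta> \<in> compositions n" "comp_set \<beta> \<subseteq> comp_set \<alpha>"
  shows "\<exists>bs. concat bs = \<alpha> \<and> map sum_list bs = \<beta>"
  using assms
proof (induction \<beta> arbitrary: \<alpha> n)
  case Nil
  then show ?case by auto
next
  case (Cons b \<beta>)
  show ?case
  proof (cases "\<beta> = []")
    case True
    then show ?thesis
      using Cons.prems compositions_sum_list by (intro exI[of _ "[\<alpha>]"]) auto
  next
    case False
    have sub: "insert b ((+) b ` comp_set \<beta>) \<subseteq> comp_set \<alpha>"
      using Cons.prems(3) False by (simp add: comp_set_Cons)
    then obtain k where k: "1 \<le> k" "k < length \<alpha>" "b = sum_list (take k \<alpha>)"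
      by (auto simp: comp_set_def)
    have split: "sum_list \<alpha> = b + sum_list (drop k \<alpha>)"
      using k(3) by (metis append_take_drop_id sum_list_append)
    have drop: "drop k \<alpha> \<in> compositions (n - b)"
      using Cons.prems(1) split by (auto simp: compositions_def dest: in_set_dropD)
    have \<beta>: "\<beta> \<in> compositions (n - b)" using Cons.prems by auto
    \<comment> \<open>Adding \<open>b\<close> turns a partial sum of \<beta> into one of \<alpha>,
      taken at some index \<open>j\<close>. As it exceeds \<open>b\<close>, the cut at
      \<open>j\<close> lies beyond \<open>k\<close>, and removing the first \<open>k\<close> parts
      leaves the original sum.\<close>
    have "comp_set \<beta> \<subseteq> comp_set (drop k \<alpha>)"
    proof
      fix x assume x: "x \<in> comp_set \<beta>"
      then have "0 < x" using comp_set_subset[OF \<beta>] by auto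
      from x sub have "b + x \<in> comp_set \<alpha>" by auto
      then obtain j where j: "1 \<le> j" "j < length \<alpha>" "b + x = sum_list (take j \<alpha>)"
        by (auto simp: comp_set_def)
      have "k < j"
      proof (rule ccontr)
        assume "\<not> k < j"
        then have "take k \<alpha> = take j \<alpha> @ take (k - j) (drop j \<alpha>)"
          by (simp flip: take_add)
        then have "sum_list (take j \<alpha>) \<le> sum_list (take k \<alpha>)" by simp
        then show False using j k \<open>0 < x\<close> by simp
      qed
      then have "take j \<alpha> = take k \<alpha> @ take (j - k) (drop k \<alpha>)"
        by (simp flip: take_add)
      then have "x = sum_list (take (j - k) (drop k \<alpha>))" using j k by simp
      then show "x \<in> comp_set (drop k \<alpha>)"
        using \<open>k < j\<close> j by (auto simp: comp_set_def intro!: exI[of _ "j - k"])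
    qed
    then obtain bs where "concat bs = drop k \<alpha>" "map sum_list bs = \<beta>"
      using Cons.IH[OF drop \<beta>] by auto
    then show ?thesis using k by (intro exI[of _ "take k \<alpha> # bs"]) auto
  qed
qed

lemma blocks_props:
  assumes "\<alpha> \<preceq> \<beta>"
  shows "concat (blocks \<alpha> \<beta>) = \<alpha>" "map sum_list (blocks \<alpha> \<beta>) = \<beta>"
proof -
  obtain n where n: "\<alpha> \<in> compositions n" "\<beta> \<in> compositions n" "comp_set \<beta> \<subseteq> comp_set \<alpha>"
    using assms by (auto simp: refines_def)
  have "\<forall>a\<in>set \<alpha>. 0 < a" using n by (auto simp: compositions_def)
  then have "\<exists>!bs. concat bs = \<alpha> \<and> map sum_list bs = \<beta>"
    using blocks_exist[OF n] blocks_unique by metis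
  from theI'[OF this, folded blocks_def]
  show "concat (blocks \<alpha> \<beta>) = \<alpha>" "map sum_list (blocks \<alpha> \<beta>) = \<beta>" by auto
qed

lemma length_concat_blocks:
  assumes "\<alpha> \<preceq> \<beta>"
  shows "sum_list (map length (blocks \<alpha> \<beta>)) = length \<alpha>"
  using blocks_props(1)[OF assms] by (metis length_concat)

text \<open>An empty block would give \<beta> a part 0. The counting below needs positive block
  sizes, since \<open>partition_on\<close> excludes empty sets.\<close>

lemma blocks_nonempty:
  assumes "\<alpha> \<preceq> \<beta>" "b \<in> set (blocks \<alpha> \<beta>)"
  shows "b \<noteq> []"
proof
  assume "b = []"
  then have "sum_list [] \<in> set (map sum_list (blocks \<alpha> \<beta>))"
    using assms(2) by (metis image_eqI set_map)
  then have "0 \<in> set \<beta>" using blocks_props(2)[OF assms(1)] by simp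
  then show False using assms(1) by (auto simp: refines_def compositions_def)
qed

text \<open>The blocks concatenate to \<alpha>, so their products of parts combine to one that does
  not depend on \<beta>; only the factorials do.\<close>

lemma sp_rel_eq:
  assumes "\<alpha> \<preceq> \<beta>"
  shows "sp_rel \<alpha> \<beta> = prod_list (map (fact \<circ> length) (blocks \<alpha> \<beta>)) * prod_list \<alpha>"
proof -
  have "prod_list (map sp bs) = prod_list (map (fact \<circ> length) bs) * prod_list (concat bs)" for bs
    by (induction bs) (auto simp: sp_def)
  then show ?thesis using blocks_props(1)[OF assms] by (simp add: sp_rel_def)
qed

section \<open>Counting ordered set partitions with prescribed block sizes\<close>

definition ordered_partitions :: "'a set \<Rightarrow> nat list \<Rightarrow> 'a set list set" where
  "ordered_partitions A ks = {Bs. distinct Bs \<and> partition_on A (set Bs) \<and> map card Bs = ks}"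

text \<open>Removing the first block leaves an ordered partition of \<open>A - B\<close>, which is
  why the ground set is arbitrary. Positivity of \<open>k\<close> makes \<open>B\<close> nonempty,
  so disjointness from the other blocks implies that \<open>B\<close> is not among them.\<close>

lemma Cons_ordered_partitions:
  assumes "finite A" "0 < k"
  shows "B # Bs \<in> ordered_partitions A (k # ks) \<longleftrightarrow>
    B \<subseteq> A \<and> card B = k \<and> Bs \<in> ordered_partitions (A - B) ks"
proof
  assume *: "B # Bs \<in> ordered_partitions A (k # ks)"
  then have "disjnt B (\<Union>(set Bs))"
    by (auto simp: ordered_partitions_def partition_on_def disjnt_def disjoint_def)
  then show "B \<subseteq> A \<and> card B = k \<and> Bs \<in> ordered_partitions (A - B) ks"
    using * by (auto simp: ordered_partitions_def partition_on_insert)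
next
  assume *: "B \<subseteq> A \<and> card B = k \<and> Bs \<in> ordered_partitions (A - B) ks"
  then have 1: "disjnt B (\<Union>(set Bs))"
    by (auto simp: ordered_partitions_def partition_on_def disjnt_def)
  have 2: "B \<noteq> {}" using * assms by auto
  then have "B \<notin> set Bs" using 1 by (auto simp: disjnt_def)
  then show "B # Bs \<in> ordered_partitions A (k # ks)"
    using * 1 2 by (auto simp: ordered_partitions_def partition_on_insert)
qed

text \<open>The multinomial count by induction: the first block is any \<open>k\<close>-subset and
  contributes a binomial coefficient. The product form avoids division of natural numbers.\<close>

lemma card_ordered_partitions:
  assumes "finite A" "card A = sum_list ks" "\<forall>k\<in>set ks. 0 < k"
  shows "finite (ordered_partitions A ks) \<and>
    card (ordered_partitions A ks) * prod_list (map fact ks) = fact (card A)"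
  using assms
proof (induction ks arbitrary: A)
  case Nil
  then have "ordered_partitions A [] = {[]}"
    by (auto simp: ordered_partitions_def partition_on_empty)
  then show ?case using Nil by simp
next
  case (Cons k ks)
  let ?S = "{B. B \<subseteq> A \<and> card B = k}"
  let ?f = "\<lambda>B. (#) B ` ordered_partitions (A - B) ks"
  have k: "0 < k" "k \<le> card A" using Cons.prems by auto
  have eq: "ordered_partitions A (k # ks) = (\<Union>B\<in>?S. ?f B)"
  proof (rule set_eqI)
    fix Bs
    show "Bs \<in> ordered_partitions A (k # ks) \<longleftrightarrow> Bs \<in> (\<Union>B\<in>?S. ?f B)"
      using Cons_ordered_partitions[OF Cons.prems(1) k(1), of _ _ ks]
      by (cases Bs) (auto simp: ordered_partitions_def[of A "k # ks"])
  qed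
  have finS: "finite ?S" using Cons.prems(1) by simp
  have IH: "finite (ordered_partitions (A - B) ks)"
      "card (ordered_partitions (A - B) ks) * prod_list (map fact ks) = fact (card A - k)"
    if "B \<in> ?S" for B
  proof -
    have "card (A - B) = card A - k"
      using that Cons.prems(1) by (auto simp: card_Diff_subset finite_subset)
    then show "finite (ordered_partitions (A - B) ks)"
      "card (ordered_partitions (A - B) ks) * prod_list (map fact ks) = fact (card A - k)"
      using Cons.IH[of "A - B"] Cons.prems by auto
  qed
  \<comment> \<open>Lists with different heads differ, so the union is disjoint.\<close>
  have "card (ordered_partitions A (k # ks)) = (\<Sum>B\<in>?S. card (?f B))"
    unfolding eq by (rule card_UN_disjoint) (use finS IH in auto)
  also have "\<dots> = (\<Sum>B\<in>?S. card (ordered_partitions (A - B) ks))"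
    by (intro sum.cong) (auto simp: card_image)
  finally have "card (ordered_partitions A (k # ks)) * prod_list (map fact ks)
      = (\<Sum>B\<in>?S. fact (card A - k))"
    using IH(2) by (simp add: sum_distrib_right)
  also have "\<dots> = (card A choose k) * fact (card A - k)"
    using n_subsets[OF Cons.prems(1)] by simp
  finally have "card (ordered_partitions A (k # ks)) * prod_list (map fact (k # ks))
      = fact k * fact (card A - k) * (card A choose k)"
    by (simp add: mult_ac)
  also have "\<dots> = fact (card A)"
    by (rule binomial_fact_lemma[OF k(2)])
  finally show ?case
    using IH(1) finS unfolding eq by auto
qed

lemma OSP_eq_ordered_partitions:
  assumes "\<alpha> \<preceq> \<beta>"
  shows "OSP \<alpha> \<beta> = ordered_partitions {1..length \<alpha>} (map length (blocks \<alpha> \<beta>))"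
proof -
  have "length (blocks \<alpha> \<beta>) = length \<beta>"
    using blocks_props(2)[OF assms] by (metis length_map)
  then have "map card Bs = map length (blocks \<alpha> \<beta>) \<longleftrightarrow> length Bs = length \<beta> \<and>
      (\<forall>i<length \<beta>. card (Bs ! i) = length (blocks \<alpha> \<beta> ! i))" for Bs :: "nat set list"
    by (auto simp: list_eq_iff_nth_eq)
  then show ?thesis
    using assms by (simp add: OSP_def ordered_partitions_def)
qed

lemma card_OSP:
  assumes "\<alpha> \<preceq> \<beta>"
  shows "card (OSP \<alpha> \<beta>) * prod_list (map (fact \<circ> length) (blocks \<alpha> \<beta>)) = fact (length \<alpha>)"
proof -
  have "\<forall>k\<in>set (map length (blocks \<alpha> \<beta>)). 0 < k"
    using blocks_nonempty[OF assms] by auto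
  then show ?thesis
    using card_ordered_partitions[of "{1..length \<alpha>}" "map length (blocks \<alpha> \<beta>)"]
    unfolding OSP_eq_ordered_partitions[OF assms] length_concat_blocks[OF assms] by simp
qed

section \<open>Coefficients of \<open>Phi\<close> in terms of \<open>OSP\<close>\<close>

lemma prod_power_count_list:
  fixes xs :: "nat list"
  assumes "finite A" "set xs \<subseteq> A"
  shows "(\<Prod>i\<in>A. i ^ count_list xs i) = prod_list xs"
  using assms(2)
proof (induction xs)
  case (Cons x xs)
  \<comment> \<open>Prepending \<open>x\<close> raises only the exponent at the index
    \<open>x\<close>, by one.\<close>
  have "(\<Prod>i\<in>A. i ^ count_list (x # xs) i)
      = (\<Prod>i\<in>A. (if i = x then i else 1) * i ^ count_list xs i)"
    by (intro prod.cong) auto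
  then show ?case
    using Cons assms(1) by (simp add: prod.distrib)
qed auto

lemma set_composition: "\<alpha> \<in> compositions n \<Longrightarrow> set \<alpha> \<subseteq> {1..n}"
  using member_le_sum_list by (fastforce simp: compositions_def)

lemma z_comp_eq:
  assumes "\<alpha> \<in> compositions n"
  shows "z_comp \<alpha> = prod_list \<alpha> * (\<Prod>i=1..n. fact (count_list \<alpha> i))"
  using prod_power_count_list[OF _ set_composition[OF assms]] compositions_sum_list[OF assms]
  by (simp add: z_comp_def prod.distrib)

text \<open>All parts lie in \<open>{1..n}\<close>, so the multiplicities add up to the number of
  parts.\<close>

lemma multinomial_count_list:
  assumes "\<alpha> \<in> compositions n"
  shows "(multinomial (map (count_list \<alpha>) [1..<n+1]) :: 'a::field_char_0)
    = fact (length \<alpha>) / (\<Prod>i=1..n. fact (count_list \<alpha> i))"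
proof -
  have eq: "{1..<n+1} = {1..n}" by auto
  have "sum_list (map (count_list \<alpha>) [1..<n+1]) = length \<alpha>"
    using sum_count_set[OF set_composition[OF assms]]
    by (simp only: sum_list_distinct_conv_sum_set distinct_upt set_upt eq) simp
  moreover have "prod_list (map fact (map (count_list \<alpha>) [1..<n+1]))
      = (\<Prod>i=1..n. fact (count_list \<alpha> i) :: 'a)"
    unfolding map_map
    by (simp only: prod.distinct_set_conv_list[symmetric] distinct_upt set_upt eq o_def)
  ultimately show ?thesis by (simp add: multinomial_def del: upt_Suc)
qed

text \<open>With \<open>P\<close> and \<open>Q\<close> as in the proof, both sides equal
  \<open>Q / P\<close>: on the left \<open>prod_list \<alpha>\<close> cancels, on the right the
  number of ordered partitions does, since its product with \<open>P\<close> is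
  \<open>fact (length \<alpha>)\<close>.\<close>

lemma z_comp_over_sp_rel:
  assumes "\<alpha> \<in> compositions n" "\<alpha> \<preceq> \<beta>"
  shows "of_nat (z_comp \<alpha>) * (1 / of_nat (sp_rel \<alpha> \<beta>)) =
    inverse (multinomial (map (count_list \<alpha>) [1..<n+1])) *
      (of_nat (card (OSP \<alpha> \<beta>)) :: 'a::field_char_0)"
proof -
  define P :: nat where "P = prod_list (map (fact \<circ> length) (blocks \<alpha> \<beta>))"
  define Q :: nat where "Q = (\<Prod>i=1..n. fact (count_list \<alpha> i))"
  have c: "of_nat (card (OSP \<alpha> \<beta>)) * of_nat P = (fact (length \<alpha>) :: 'a)"
    using card_OSP[OF assms(2), folded P_def] by (metis of_nat_mult of_nat_fact)
  \<comment> \<open>A factorial is nonzero, hence so are its two factors, which permits the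
    cancellation.\<close>
  then have "P \<noteq> 0" "card (OSP \<alpha> \<beta>) \<noteq> 0"
    by (metis fact_nonzero mult_zero_left mult_zero_right of_nat_0)+
  moreover have "prod_list \<alpha> \<noteq> 0"
    using assms(1) by (auto simp: compositions_def prod_list_zero_iff)
  moreover have "multinomial (map (count_list \<alpha>) [1..<n+1]) = (fact (length \<alpha>) / of_nat Q :: 'a)"
    unfolding multinomial_count_list[OF assms(1)] Q_def by simp
  ultimately show ?thesis
    using z_comp_eq[OF assms(1), folded Q_def] sp_rel_eq[OF assms(2), folded P_def]
    by (simp flip: c del: upt_Suc)
qed

section \<open>Moebius inversion between \<open>Mqsym\<close> and \<open>Fqsym\<close>\<close>

lemma minus_one_powi_length:
  assumes "\<gamma> \<in> compositions n" "\<beta> \<in> compositions n"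
  shows "(-1) powi (int (length \<gamma>) - int (length \<beta>)) =
    ((-1) ^ (card (comp_set \<beta>) + card (comp_set \<gamma>)) :: 'a::field_char_0)"
\<comment> \<open>For positive \<open>n\<close> each length is one more than the size of its set, so
  the ones cancel in the difference; for \<open>n = 0\<close> both lists are empty. Only parity
  matters, so the difference can become a sum.\<close>
proof (cases "n = 0")
  case True
  then show ?thesis using assms by simp
next
  case False
  then obtain b \<beta>' c \<gamma>' where "\<beta> = b # \<beta>'" "\<gamma> = c # \<gamma>'"
    using assms by (cases \<beta>; cases \<gamma>) auto
  then show ?thesis
    using card_comp_set[OF assms(1)] card_comp_set[OF assms(2)]
    by (simp add: power_int_diff power_add minus_one_power_iff)
qed

text \<open>Between a proper subset \<open>B\<close> of \<open>D\<close> and \<open>D\<close> lie as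
  many sets of even as of odd size. Otherwise the interval is \<open>{D}\<close> or empty.\<close>

lemma sum_interval_alternating:
  assumes "finite D"
  shows "(\<Sum>C | B \<subseteq> C \<and> C \<subseteq> D. (-1) ^ (card B + card C)) = (if B = D then 1 else (0::'a::ring_1))"
proof (cases "B \<subset> D")
  case True
  have "(\<Sum>C\<in>{C. C \<subseteq> D \<and> B \<subseteq> C}. (-1) ^ card C) = (0::'a)"
    using card_subsupersets_even_odd[OF assms True] assms
    by (intro sum_alternating_cancels) (auto simp: conj_assoc)
  then show ?thesis
    using True by (auto simp: power_add conj_commute simp flip: sum_distrib_left)
next
  case False
  show ?thesis
  proof (cases "B = D")
    case True
    then have "{C. B \<subseteq> C \<and> C \<subseteq> D} = {D}" by auto
    then show ?thesis using True by (simp flip: mult_2)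
  next
    case ne: False
    with False have "{C. B \<subseteq> C \<and> C \<subseteq> D} = {}" by auto
    then show ?thesis using ne by (simp only: sum.empty) simp
  qed
qed

text \<open>After each \<open>Fqsym \<gamma>\<close> is expanded and the sums are exchanged, the
  coefficient of \<open>Mqsym \<delta>\<close> is an alternating sum over the sets between
  \<open>comp_set \<beta>\<close> and \<open>comp_set \<delta>\<close>, which survives only for
  \<open>\<delta> = \<beta>\<close>.\<close>

lemma Mqsym_eq_sum_Fqsym:
  assumes "\<beta> \<in> compositions n"
  shows "(Mqsym \<beta> m :: 'a::field_char_0) =
    (\<Sum>\<gamma> | \<gamma> \<in> compositions n \<and> \<gamma> \<preceq> \<beta>.
       (-1) powi (int (length \<gamma>) - int (length \<beta>)) * Fqsym \<gamma> m)"
proof -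
  let ?e = "\<lambda>\<gamma>. (-1) ^ (card (comp_set \<beta>) + card (comp_set \<gamma>)) :: 'a"
  let ?A = "{\<gamma> \<in> compositions n. \<gamma> \<preceq> \<beta>}"
  have finA: "finite ?A" using finite_compositions by simp
  have inner: "(\<Sum>\<gamma> | \<gamma> \<in> ?A \<and> \<delta> \<preceq> \<gamma>. ?e \<gamma>) = (if \<delta> = \<beta> then 1 else 0)"
    if \<delta>: "\<delta> \<in> compositions n" for \<delta>
  proof -
    have A: "{\<gamma>. \<gamma> \<in> ?A \<and> \<delta> \<preceq> \<gamma>} =
        {\<gamma> \<in> compositions n. comp_set \<beta> \<subseteq> comp_set \<gamma> \<and> comp_set \<gamma> \<subseteq> comp_set \<delta>}"
      by (auto simp: refines_iff(1)[OF \<delta>] refines_iff(2)[OF assms])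
    \<comment> \<open>The map is onto because every such \<open>C\<close> lies in
      \<open>comp_set \<delta>\<close>, hence in \<open>{1..<n}\<close>.\<close>
    have "bij_betw comp_set {\<gamma>. \<gamma> \<in> ?A \<and> \<delta> \<preceq> \<gamma>}
        {C. comp_set \<beta> \<subseteq> C \<and> C \<subseteq> comp_set \<delta>}"
      unfolding A
    proof (intro bij_betw_imageI inj_onI set_eqI iffI)
      fix C assume "C \<in> {C. comp_set \<beta> \<subseteq> C \<and> C \<subseteq> comp_set \<delta>}"
      moreover from this obtain \<gamma> where "\<gamma> \<in> compositions n" "comp_set \<gamma> = C"
        using comp_set_surj[of C n] comp_set_subset[OF \<delta>] by blast
      ultimately show "C \<in> comp_set ` {\<gamma> \<in> compositions n.
          comp_set \<beta> \<subseteq> comp_set \<gamma> \<and> comp_set \<gamma> \<subseteq> comp_set \<delta>}" by blast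
    qed (auto dest: comp_set_inj)
    from sum.reindex_bij_betw[OF this, of "\<lambda>C. (-1) ^ (card (comp_set \<beta>) + card C) :: 'a"]
    show ?thesis
      using comp_set_inj[OF \<delta> assms] finite_comp_set
      by (auto simp: sum_interval_alternating)
  qed
  have "(\<Sum>\<gamma>\<in>?A. (-1) powi (int (length \<gamma>) - int (length \<beta>)) * Fqsym \<gamma> m)
      = (\<Sum>\<gamma>\<in>?A. \<Sum>\<delta> | \<delta> \<in> compositions n \<and> \<delta> \<preceq> \<gamma>. ?e \<gamma> * Mqsym \<delta> m)"
  proof (intro sum.cong refl)
    fix \<gamma> assume "\<gamma> \<in> ?A"
    then have \<gamma>: "\<gamma> \<in> compositions n" by simp
    \<comment> \<open>Everything finer than \<gamma> is a composition of the same \<open>n\<close>;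
      saying so gives both sums finite ranges, as the exchange requires.\<close>
    then have "{\<delta>. \<delta> \<preceq> \<gamma>} = {\<delta> \<in> compositions n. \<delta> \<preceq> \<gamma>}"
      by (auto simp: refines_iff(2))
    then show "(-1) powi (int (length \<gamma>) - int (length \<beta>)) * Fqsym \<gamma> m
        = (\<Sum>\<delta> | \<delta> \<in> compositions n \<and> \<delta> \<preceq> \<gamma>. ?e \<gamma> * Mqsym \<delta> m)"
      by (simp only: Fqsym_def sum_distrib_left minus_one_powi_length[OF \<gamma> assms])
  qed
  also have "\<dots> = (\<Sum>\<delta>\<in>compositions n. \<Sum>\<gamma> | \<gamma> \<in> ?A \<and> \<delta> \<preceq> \<gamma>. ?e \<gamma> * Mqsym \<delta> m)"
    by (rule sum.swap_restrict[OF finA finite_compositions])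
  also have "\<dots> = (\<Sum>\<delta>\<in>compositions n. (if \<delta> = \<beta> then 1 else 0) * Mqsym \<delta> m)"
    by (intro sum.cong refl) (simp only: inner flip: sum_distrib_right)
  also have "\<dots> = Mqsym \<beta> m"
    using assms finite_compositions[of n] by (simp add: if_distrib[of "\<lambda>x. x * _"] cong: if_cong)
  finally show ?thesis by simp
qed

section \<open>Expansion of \<open>Phi\<close> in the functions \<open>Fqsym\<close>\<close>

theorem theorem4p6:
  fixes n :: nat and \<alpha> :: "nat list"
  assumes "\<alpha> \<in> compositions n"
  shows "(Phi \<alpha> :: 'a::field_char_0 power_series) =
    (\<lambda>m. inverse (multinomial (map (count_list \<alpha>) [1..<n+1])) *
      (\<Sum>\<gamma>\<in>compositions n.
         (\<Sum>\<beta> | coarsening \<gamma> \<alpha> \<preceq> \<beta>.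
            (-1) powi (int (length \<gamma>) - int (length \<beta>)) * of_nat (card (OSP \<alpha> \<beta>))) * Fqsym \<gamma> m))"
proof
  fix m
  let ?e = "\<lambda>\<gamma> \<beta>. (-1) powi (int (length \<gamma>) - int (length \<beta>)) :: 'a"
  let ?c = "inverse (multinomial (map (count_list \<alpha>) [1..<n+1])) :: 'a"
  let ?o = "\<lambda>\<beta>. of_nat (card (OSP \<alpha> \<beta>)) :: 'a"
  let ?B = "{\<beta>. \<alpha> \<preceq> \<beta>}"
  \<comment> \<open>Everything coarser than \<alpha> is a composition of \<open>n\<close>, so the
    sum is finite and the inversion formula applies to each \<beta>.\<close>
  have B: "?B \<subseteq> compositions n" using assms by (auto simp: refines_iff)
  then have finB: "finite ?B" using finite_compositions finite_subset by blast
  have "Phi \<alpha> m = (\<Sum>\<beta>\<in>?B. (of_nat (z_comp \<alpha>) * (1 / of_nat (sp_rel \<alpha> \<beta>))) * Mqsym \<beta> m)"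
    by (simp only: Phi_def sum_distrib_left mult.assoc)
  also have "\<dots> = (\<Sum>\<beta>\<in>?B. (?c * ?o \<beta>) * Mqsym \<beta> m)"
    by (rule sum.cong[OF refl]) (simp only: z_comp_over_sp_rel[OF assms] mem_Collect_eq)
  also have "\<dots> = ?c * (\<Sum>\<beta>\<in>?B. ?o \<beta> * Mqsym \<beta> m)"
    by (simp only: sum_distrib_left mult.assoc)
  finally have Phi: "Phi \<alpha> m = ?c * (\<Sum>\<beta>\<in>?B. ?o \<beta> * Mqsym \<beta> m)" .
  have "(\<Sum>\<beta>\<in>?B. ?o \<beta> * Mqsym \<beta> m)
      = (\<Sum>\<beta>\<in>?B. \<Sum>\<gamma> | \<gamma> \<in> compositions n \<and> \<gamma> \<preceq> \<beta>. ?o \<beta> * (?e \<gamma> \<beta> * Fqsym \<gamma> m))"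
  proof (rule sum.cong[OF refl])
    fix \<beta> assume "\<beta> \<in> ?B"
    with B have "\<beta> \<in> compositions n" by blast
    then show "?o \<beta> * Mqsym \<beta> m
        = (\<Sum>\<gamma> | \<gamma> \<in> compositions n \<and> \<gamma> \<preceq> \<beta>. ?o \<beta> * (?e \<gamma> \<beta> * Fqsym \<gamma> m))"
      by (simp only: Mqsym_eq_sum_Fqsym sum_distrib_left)
  qed
  also have "\<dots> = (\<Sum>\<gamma>\<in>compositions n. \<Sum>\<beta> | \<beta> \<in> ?B \<and> \<gamma> \<preceq> \<beta>. ?o \<beta> * (?e \<gamma> \<beta> * Fqsym \<gamma> m))"
    by (rule sum.swap_restrict[OF finB finite_compositions])
  also have "\<dots> = (\<Sum>\<gamma>\<in>compositions n. (\<Sum>\<beta> | coarsening \<gamma> \<alpha> \<preceq> \<beta>. ?e \<gamma> \<beta> * ?o \<beta>) * Fqsym \<gamma> m)"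
  proof (rule sum.cong[OF refl])
    fix \<gamma> assume "\<gamma> \<in> compositions n"
    \<comment> \<open>This is the least upper bound property of the coarsening.\<close>
    then have "{\<beta>. \<beta> \<in> ?B \<and> \<gamma> \<preceq> \<beta>} = {\<beta>. coarsening \<gamma> \<alpha> \<preceq> \<beta>}"
      using coarsening_refines_iff[OF _ assms] by blast
    then show "(\<Sum>\<beta> | \<beta> \<in> ?B \<and> \<gamma> \<preceq> \<beta>. ?o \<beta> * (?e \<gamma> \<beta> * Fqsym \<gamma> m))
        = (\<Sum>\<beta> | coarsening \<gamma> \<alpha> \<preceq> \<beta>. ?e \<gamma> \<beta> * ?o \<beta>) * Fqsym \<gamma> m"
      by (simp add: sum_distrib_left mult_ac)
  qed
  finally have swap: "(\<Sum>\<beta>\<in>?B. ?o \<beta> * Mqsym \<beta> m) = (\<Sum>\<gamma>\<in>compositions n.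
      (\<Sum>\<beta> | coarsening \<gamma> \<alpha> \<preceq> \<beta>. ?e \<gamma> \<beta> * ?o \<beta>) * Fqsym \<gamma> m)" .
  show "Phi \<alpha> m = ?c * (\<Sum>\<gamma>\<in>compositions n.
      (\<Sum>\<beta> | coarsening \<gamma> \<alpha> \<preceq> \<beta>. ?e \<gamma> \<beta> * ?o \<beta>) * Fqsym \<gamma> m)"
    unfolding Phi swap ..
qed

end
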